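(* In angular search (the algorithm described in the context), at iteration $t$, $$\frac{\Phi(y^* )}{\Phi(\hat y^t)}\le (v_1)^{\frac{4}{t+1}},$$ where $y^*=\arg\max_{y\in\mathcal{Y}}\Phi(y)$, $\hat y^t$ is the best label (largest $\Phi$) found up to iteration $t$, $$v_1=\max\left\{\frac{\lambda_0}{\partial(y_1)},\ \frac{\partial(y_1)}{\lambda_0}\right\},$$ $\lambda_0$ is the initial $\lambda$ used, and $y_1$ is the first label returned by the constrained $\lambda$-oracle.
   Context: $\mathcal{Y}$ is a set of labels, $h:\mathcal{Y}\to\mathbb{R}$, $g:\mathcal{Y}\to[0,\infty)$, and $\Phi(y)=h(y)g(y)$. For a vector $a=(a_1,a_2)$ write $\partial(a)=a_2/a_1$ for its slope; a label $y$ is identified with the vector $(h(y),g(y))$, so $\partial(y)=g(y)/h(y)$. Constrained $\lambda$-oracle: $\mathcal{O}_c(\lambda,\alpha,\beta)$ returns a maximizer of $h(y)+\lambda g(y)$ over the labels $y\in\mathcal{Y}$ with $\alpha h(y)\ge g(y)$ and $\beta h(y)<g(y)$. The variant $\underline{\mathcal{O}}_c(\lambda,\alpha,\beta)$ is the same with the place of the equality swapped, i.e. over the labels with $\alpha h(y)>g(y)$ and $\beta h(y)\le g(y)$. Each returns $\emptyset$ if there is no such label. For $\alpha=\infty$ the constraint involving $\alpha$ is read as $h(y)>0$. Angular search: the inputs are $\lambda_0>0$ and a maximum iteration number $T$. Initialize $\alpha_0=\infty$, $\beta_0=0$, $\lambda=\lambda_0$, $\hat y=\emptyset$, and a queue containing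 only $(\alpha_0,\beta_0,0)$. While the queue is nonempty, perform an iteration: (1) Dequeue $(\alpha,\beta,s)$. If $\beta\ne0$, set $\lambda=1/\sqrt{\alpha\beta}$ (otherwise $\lambda$ is unchanged). (2) Let $y=\mathcal{O}_c(\lambda,\alpha,\beta)$ if $s=0$ and $y=\underline{\mathcal{O}}_c(\lambda,\alpha,\beta)$ otherwise. If $y$ is a label with $\Phi(y)>\Phi(\hat y)$ (or $\hat y=\emptyset$), set $\hat y=y$. (3) If $y\ne\emptyset$, let $z=(h(y),g(y))$, $z'=(\lambda g(y),\frac1\lambda h(y))$ and $r=(\sqrt{\lambda h(y)g(y)},\sqrt{\frac1\lambda h(y)g(y)})$. If $z_1=z'_1$, return $y$. Otherwise, if $\partial(z)>\partial(z')$, enqueue $(\partial(z),\partial(r),1)$ and $(\partial(r),\partial(z'),0)$; else enqueue $(\partial(z'),\partial(r),1)$ and $(\partial(r),\partial(z),0)$. (4) If $T$ iterations have been made, return $\hat y$. When the queue is empty the output is $\hat y$.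
   Formalization: In v_1, λ_0 is replaced by 1/λ_0: v_1 = max{(1/λ_0)/∂(y_1), ∂(y_1)/(1/λ_0)}. As printed the bound is false: for labels (h,g) = (1,2), (12/5,5/4) and λ_0 = 2, y_1 = (1,2) gives v_1 = 1, but at t = 1 the ratio is 3/2. *)

theory Defs
  imports "HOL-Library.Extended_Real"
begin

definition Phi :: "('y \<Rightarrow> real) \<Rightarrow> ('y \<Rightarrow> real) \<Rightarrow> 'y \<Rightarrow> real" where
  "Phi h g y = h y * g y"

definition slope :: "real \<times> real \<Rightarrow> real" where
  "slope a = snd a / fst a"

definition label_vec :: "('y \<Rightarrow> real) \<Rightarrow> ('y \<Rightarrow> real) \<Rightarrow> 'y \<Rightarrow> real \<times> real" where
  "label_vec h g y = (h y, g y)"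

text \<open>
  The upper bound on the slope of a label is extended real; the value infinity stands for the
  constraint \<open>h y > 0\<close> in both kinds of oracles. Minus infinity never occurs.
\<close>

definition feasible ::
  "'y set \<Rightarrow> ('y \<Rightarrow> real) \<Rightarrow> ('y \<Rightarrow> real) \<Rightarrow> ereal \<Rightarrow> real \<Rightarrow> 'y set" where
  "feasible Y h g \<alpha> \<beta> =
    {y \<in> Y. (case \<alpha> of ereal a \<Rightarrow> a * h y \<ge> g y | PInfty \<Rightarrow> h y > 0 | MInfty \<Rightarrow> False)
          \<and> \<beta> * h y < g y}"

definition feasible_swapped ::
  "'y set \<Rightarrow> ('y \<Rightarrow> real) \<Rightarrow> ('y \<Rightarrow> real) \<Rightarrow> ereal \<Rightarrow> real \<Rightarrow> 'y set" where
  "feasible_swapped Y h g \<alpha> \<beta> =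
    {y \<in> Y. (case \<alpha> of ereal a \<Rightarrow> a * h y > g y | PInfty \<Rightarrow> h y > 0 | MInfty \<Rightarrow> False)
          \<and> \<beta> * h y \<le> g y}"

text \<open>
  Oracles are arbitrary functions returning some maximizer (ties are broken arbitrarily), and \<open>None\<close>
  exactly when there is no feasible label. They are only required to be correct on arguments
  with \<open>\<lambda> > 0\<close> and \<open>0 \<le> \<beta> < \<alpha>\<close>.
\<close>

type_synonym 'y lambda_oracle = "real \<Rightarrow> ereal \<Rightarrow> real \<Rightarrow> 'y option"

definition maximizing_oracle ::
  "(ereal \<Rightarrow> real \<Rightarrow> 'y set) \<Rightarrow> ('y \<Rightarrow> real) \<Rightarrow> ('y \<Rightarrow> real) \<Rightarrow> 'y lambda_oracle \<Rightarrow> bool" where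
  "maximizing_oracle F h g orc \<longleftrightarrow>
    (\<forall>lam \<alpha> \<beta>. 0 < lam \<longrightarrow> 0 \<le> \<beta> \<longrightarrow> ereal \<beta> < \<alpha> \<longrightarrow>
      (case orc lam \<alpha> \<beta> of
         None \<Rightarrow> F \<alpha> \<beta> = {}
       | Some y \<Rightarrow> is_arg_max (\<lambda>y. h y + lam * g y) (\<lambda>y. y \<in> F \<alpha> \<beta>) y))"

definition constrained_oracle ::
  "'y set \<Rightarrow> ('y \<Rightarrow> real) \<Rightarrow> ('y \<Rightarrow> real) \<Rightarrow> 'y lambda_oracle \<Rightarrow> bool" where
  "constrained_oracle Y h g = maximizing_oracle (feasible Y h g) h g"

definition constrained_oracle_swapped ::
  "'y set \<Rightarrow> ('y \<Rightarrow> real) \<Rightarrow> ('y \<Rightarrow> real) \<Rightarrow> 'y lambda_oracle \<Rightarrow> bool" where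
  "constrained_oracle_swapped Y h g = maximizing_oracle (feasible_swapped Y h g) h g"

text \<open>
  \<open>returned\<close> is \<open>Some y\<close> once the search has stopped by returning a label \<open>y\<close> with
  \<open>h y = \<lambda> * g y\<close>. The queue is first-in first-out, its front being the head of the list.
\<close>

record 'y search_state =
  queue :: "(ereal \<times> real \<times> nat) list"
  lam :: real
  best :: "'y option"
  returned :: "'y option"

definition initial_state :: "real \<Rightarrow> 'y search_state" where
  "initial_state lam0 = \<lparr>queue = [(\<infinity>, 0, 0)], lam = lam0, best = None, returned = None\<rparr>"

definition update_best ::
  "('y \<Rightarrow> real) \<Rightarrow> ('y \<Rightarrow> real) \<Rightarrow> 'y option \<Rightarrow> 'y \<Rightarrow> 'y option" where
  "update_best h g b y =
    (case b of None \<Rightarrow> Some y | Some x \<Rightarrow> if Phi h g y > Phi h g x then Some y else Some x)"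

definition split_range ::
  "('y \<Rightarrow> real) \<Rightarrow> ('y \<Rightarrow> real) \<Rightarrow> real \<Rightarrow> 'y \<Rightarrow> (ereal \<times> real \<times> nat) list" where
  "split_range h g l y =
    (let z = label_vec h g y;
         z' = (l * g y, 1 / l * h y);
         r = (sqrt (l * h y * g y), sqrt (1 / l * h y * g y))
     in if slope z > slope z'
        then [(ereal (slope z), slope r, 1), (ereal (slope r), slope z', 0)]
        else [(ereal (slope z'), slope r, 1), (ereal (slope r), slope z, 0)])"

text \<open>One iteration; \<open>Uc\<close> plays the role of the variant with the equality swapped.\<close>

definition iteration ::
  "('y \<Rightarrow> real) \<Rightarrow> ('y \<Rightarrow> real) \<Rightarrow> 'y lambda_oracle \<Rightarrow> 'y lambda_oracle \<Rightarrow> 'y search_state \<Rightarrow> 'y search_state"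
where
  "iteration h g Oc Uc st =
    (let (\<alpha>, \<beta>, s) = hd (queue st);
         q = tl (queue st);
         l = (if \<beta> \<noteq> 0 then 1 / sqrt (real_of_ereal \<alpha> * \<beta>) else lam st)
     in case (if s = 0 then Oc l \<alpha> \<beta> else Uc l \<alpha> \<beta>) of
          None \<Rightarrow> st\<lparr>queue := q, lam := l\<rparr>
        | Some y \<Rightarrow>
            if h y = l * g y
            then st\<lparr>queue := q, lam := l, best := update_best h g (best st) y,
                    returned := Some y\<rparr>
            else st\<lparr>queue := q @ split_range h g l y, lam := l,
                    best := update_best h g (best st) y\<rparr>)"

text \<open>
  \<open>search_reaches h g Oc Uc lam0 T t st\<close>: at least \<open>t\<close> iterations are performed (so \<open>t \<le> T\<close>, and
  no earlier iteration stopped the search or left the queue empty), and \<open>st\<close> is the state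
  after the first \<open>t\<close> of them.
\<close>

inductive search_reaches ::
  "('y \<Rightarrow> real) \<Rightarrow> ('y \<Rightarrow> real) \<Rightarrow> 'y lambda_oracle \<Rightarrow> 'y lambda_oracle \<Rightarrow> real \<Rightarrow> nat
    \<Rightarrow> nat \<Rightarrow> 'y search_state \<Rightarrow> bool"
  for h g Oc Uc lam0 T
where
  start: "search_reaches h g Oc Uc lam0 T 0 (initial_state lam0)"
| iterate: "search_reaches h g Oc Uc lam0 T t st \<Longrightarrow> t < T \<Longrightarrow> queue st \<noteq> [] \<Longrightarrow>
    returned st = None \<Longrightarrow> search_reaches h g Oc Uc lam0 T (Suc t) (iteration h g Oc Uc st)"

text \<open>
  How far the direction of a label \<open>y\<close> is from the direction of slope \<open>1 / \<lambda>\<close>, as a ratio that is at least 1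
  for a label with \<open>h y > 0\<close> and \<open>g y > 0\<close>. The two contributions to the objective
  \<open>h y + \<lambda> * g y\<close> are equal precisely at slope \<open>1 / \<lambda>\<close>, so the slope of \<open>y\<close> has to be compared with
  \<open>1 / \<lambda>\<close> and not with \<open>\<lambda>\<close>. Comparing it with \<open>\<lambda>\<close> would make the bound for angular search false:
  for the two labels \<open>(1, 2)\<close> and \<open>(12/5, 5/4)\<close> and initial value 2 the first label found is
  \<open>(1, 2)\<close>, whose slope is 2, while the other label has the larger product.
\<close>

definition slope_ratio :: "real \<Rightarrow> real \<times> real \<Rightarrow> real" where
  "slope_ratio l a = max ((1 / l) / slope a) (slope a / (1 / l))"

end

theory Submission
  imports Defs
begin

text \<open>
  On a logarithmic slope scale, an iteration with parameter \<open>\<lambda>\<close> that finds \<open>y\<close> splits its range at the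
  point \<open>1 / \<lambda>\<close> into two ranges whose common width is the distance \<open>d\<close> of \<open>y\<close> from that point.
  Because \<open>y\<close> maximizes \<open>h + \<lambda> g\<close>, a label outside both new ranges has an objective of at most
  \<open>\<Phi> y\<close>, and a label inside has at most \<open>exp d * \<Phi> y\<close>. The split point is the midpoint of the range, so the
  width is at least halved. In the first-in first-out order the children of the \<open>m\<close>-th range are at most the
  ranges number \<open>2 m\<close> and \<open>2 m + 1\<close>; hence, by induction, the \<open>n\<close>-th range has width at most
  \<open>4 * ln v\<^sub>1 / (n + 1)\<close> for \<open>n > 1\<close>. After \<open>t\<close> iterations only ranges with \<open>n > t\<close> remain.
\<close>

section \<open>Products of two positive numbers under a bound on their sum\<close>

text \<open>A more uneven division of a sum that is no larger gives a smaller product. The spread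
  condition says that the quotient \<open>b' / a'\<close> is at least \<open>b / a\<close>, which
  with \<open>a \<le> b\<close> forces \<open>a' \<le> a\<close>. If \<open>b'\<close> exceeds
  \<open>b\<close>, replacing \<open>a'\<close> by \<open>a + b - b'\<close> leaves a quadratic in
  \<open>b'\<close> that equals \<open>a * b\<close> minus a nonnegative product.\<close>

lemma prod_le_of_sum_le_of_spread:
  fixes a b a' b' :: real
  assumes "0 < a" "a \<le> b" "0 < a'" "0 < b'" "a' + b' \<le> a + b" "b * a' \<le> a * b'"
  shows "a' * b' \<le> a * b"
proof -
  have "a' * (a + b) \<le> a * (a' + b')"
    using assms by (simp add: algebra_simps)
  also have "\<dots> \<le> a * (a + b)"
    using assms by (intro mult_left_mono) auto
  finally have a': "a' \<le> a"
    using assms by simp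
  show ?thesis
  proof (cases "b' \<le> b")
    case True
    then show ?thesis using a' assms by (intro mult_mono) auto
  next
    case False
    have "a' * b' \<le> (a + b - b') * b'"
      using assms by (intro mult_right_mono) auto
    also have "\<dots> = a * b - (b' - a) * (b' - b)"
      by (simp add: algebra_simps)
    also have "\<dots> \<le> a * b"
      using False assms by simp
    finally show ?thesis .
  qed
qed

text \<open>By the inequality of arithmetic and geometric means the left side is at most
  \<open>((a + b) / 2)\<^sup>2\<close>, hence at most the square of the larger of \<open>a\<close>
  and \<open>b\<close>; that square is the larger quotient times \<open>a * b\<close>.\<close>

lemma prod_le_of_sum_le:
  fixes a b a' b' :: real
  assumes "0 < a" "0 < b" "0 < a'" "0 < b'" "a' + b' \<le> a + b"
  shows "a' * b' \<le> max (a / b) (b / a) * (a * b)"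
proof -
  have "a' * b' \<le> (max a b)\<^sup>2"
  proof -
    have "a' * b' \<le> ((a' + b') / 2)\<^sup>2"
      using sum_squares_bound[of a' b'] by (simp add: power2_eq_square field_simps)
    also have "\<dots> \<le> (max a b)\<^sup>2"
      using assms by (intro power_mono) auto
    finally show ?thesis .
  qed
  also have "\<dots> \<le> max (a / b) (b / a) * (a * b)"
  proof (cases "a \<le> b")
    case True
    have "(max a b)\<^sup>2 = (b / a) * (a * b)"
      using True assms by (simp add: power2_eq_square max_def)
    also have "\<dots> \<le> max (a / b) (b / a) * (a * b)"
      using assms by (intro mult_right_mono) auto
    finally show ?thesis .
  next
    case False
    have "(max a b)\<^sup>2 = (a / b) * (a * b)"
      using False assms by (simp add: power2_eq_square max_def)
    also have "\<dots> \<le> max (a / b) (b / a) * (a * b)"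
      using assms by (intro mult_right_mono) auto
    finally show ?thesis .
  qed
  finally show ?thesis .
qed

section \<open>Slope ratios and the two ranges of a split\<close>

text \<open>Expresses the ratio through the two terms \<open>h y\<close> and \<open>l * g y\<close>
  of the objective, the numbers to which the product inequalities are applied.\<close>

lemma slope_ratio_label:
  "slope_ratio l (label_vec h g y) = max (h y / (l * g y)) (l * g y / h y)"
  by (simp add: slope_ratio_def slope_def label_vec_def mult.commute)

lemma one_le_slope_ratio:
  assumes "0 < l" "0 < h y" "0 < g y"
  shows "1 \<le> slope_ratio l (label_vec h g y)"
  using assms by (auto simp: slope_ratio_label le_max_iff_disj field_simps)

lemma one_less_slope_ratio:
  assumes "0 < l" "0 < h y" "0 < g y" "h y \<noteq> l * g y"
  shows "1 < slope_ratio l (label_vec h g y)"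
  using assms by (auto simp: slope_ratio_label less_max_iff_disj field_simps)

text \<open>The vector \<open>r\<close> has slope \<open>1 / l\<close>, and the slopes of
  \<open>z\<close> and \<open>z'\<close> are mirror images about it on the logarithmic scale. Both
  branches of the split therefore give the same two ranges, each with end quotient
  \<open>v\<close>.\<close>

lemma split_range_eq:
  assumes l: "0 < l" and y: "0 < h y" "0 < g y"
  defines "v \<equiv> slope_ratio l (label_vec h g y)"
  shows "split_range h g l y = [(ereal (v / l), 1 / l, 1), (ereal (1 / l), 1 / (l * v), 0)]"
proof -
  have "slope (sqrt (l * h y * g y), sqrt (1 / l * h y * g y)) = sqrt (1 / l\<^sup>2)"
    using assms by (simp add: slope_def flip: real_sqrt_divide) (simp add: field_simps power2_eq_square)
  also have "\<dots> = 1 / l"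
    using l by (simp add: real_sqrt_divide)
  finally have r: "slope (sqrt (l * h y * g y), sqrt (1 / l * h y * g y)) = 1 / l" .
  have z: "slope (h y, g y) = (l * g y / h y) / l"
    using l by (simp add: slope_def)
  have z': "slope (l * g y, 1 / l * h y) = (h y / (l * g y)) / l"
    using l by (simp add: slope_def)
  \<comment> \<open>The smaller slope is rewritten as the reciprocal form of the larger, one
    equation for each branch.\<close>
  have inv: "(l * g y / h y) / l = 1 / (l * (h y / (l * g y)))"
    "(h y / (l * g y)) / l = 1 / (l * (l * g y / h y))"
    using assms by (auto simp: field_simps)
  show ?thesis
  proof (cases "h y / (l * g y) < l * g y / h y")
    case True
    then have "v = l * g y / h y" by (simp add: v_def slope_ratio_label)
    moreover have gt: "slope (h y, g y) > slope (l * g y, 1 / l * h y)"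
      unfolding z z' using True l by (intro divide_strict_right_mono)
    ultimately show ?thesis
      unfolding split_range_def label_vec_def Let_def r if_P[OF gt] z z' by (simp only: inv(2) if_True)
  next
    case False
    then have "v = h y / (l * g y)" by (simp add: v_def slope_ratio_label)
    moreover have le: "\<not> slope (h y, g y) > slope (l * g y, 1 / l * h y)"
      unfolding z z' not_less using False l by (intro divide_right_mono) auto
    ultimately show ?thesis
      unfolding split_range_def label_vec_def Let_def r if_not_P[OF le] z z' by (simp only: inv(1) if_False)
  qed
qed

text \<open>The labels among which an iteration on this queue entry maximizes. Flag 0 includes the
  upper end of the slope range, any other flag the lower end.\<close>

definition range_labels ::
  "'y set \<Rightarrow> ('y \<Rightarrow> real) \<Rightarrow> ('y \<Rightarrow> real) \<Rightarrow> ereal \<times> real \<times> nat \<Rightarrow> 'y set" where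
  "range_labels Y h g q = (case q of (\<alpha>, \<beta>, s) \<Rightarrow>
    if s = 0 then feasible Y h g \<alpha> \<beta> else feasible_swapped Y h g \<alpha> \<beta>)"

text \<open>One of the two slope constraints is always strict, so \<open>b * h x < a * h x\<close>;
  as \<open>b < a\<close>, this forces \<open>h x\<close> to be positive.\<close>

lemma range_labels_bounds:
  assumes "x \<in> range_labels Y h g (ereal a, b, s)" "0 < b" "b < a"
  shows "x \<in> Y" "0 < h x" "0 < g x" "b * h x \<le> g x" "g x \<le> a * h x"
proof -
  have *: "x \<in> Y" "b * h x \<le> g x" "g x \<le> a * h x" "b * h x < a * h x"
    using assms(1) by (auto simp: range_labels_def feasible_def feasible_swapped_def split: if_splits)
  have "0 < (a - b) * h x"
    using *(4) by (simp add: algebra_simps)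
  then have h: "0 < h x"
    using assms(3) by (simp add: zero_less_mult_iff)
  then have "0 < b * h x"
    using assms(2) by simp
  then show "x \<in> Y" "0 < h x" "0 < g x" "b * h x \<le> g x" "g x \<le> a * h x"
    using * h by auto
qed

section \<open>What a maximizer of the objective says about other labels\<close>

lemma Phi_le_slope_ratio:
  assumes l: "0 < l" and y: "0 < h y" "0 < g y" and x: "0 < h x" "0 < g x"
    and max: "h x + l * g x \<le> h y + l * g y"
  shows "Phi h g x \<le> slope_ratio l (label_vec h g y) * Phi h g y"
proof -
  have "h x * (l * g x) \<le> max (h y / (l * g y)) (l * g y / h y) * (h y * (l * g y))"
    using assms by (intro prod_le_of_sum_le) auto
  then have "l * Phi h g x \<le> l * (slope_ratio l (label_vec h g y) * Phi h g y)"
    by (simp add: slope_ratio_label Phi_def mult_ac)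
  then show ?thesis
    using l by simp
qed

text \<open>Outside both ranges the terms \<open>h x\<close> and \<open>l * g x\<close> are at least
  as uneven as those of \<open>y\<close>, and their sum is no larger, so
  \<open>prod_le_of_sum_le_of_spread\<close> applies.\<close>

lemma Phi_le_or_in_split_range:
  assumes l: "0 < l" and y: "0 < h y" "0 < g y" and x: "x \<in> Y" "0 < h x" "0 < g x"
    and max: "h x + l * g x \<le> h y + l * g y"
  shows "Phi h g x \<le> Phi h g y \<or> (\<exists>q \<in> set (split_range h g l y). x \<in> range_labels Y h g q)"
proof (rule disjCI)
  define v where "v = slope_ratio l (label_vec h g y)"
  have v: "1 \<le> v"
    using one_le_slope_ratio[where h = h and g = g, OF l y] by (simp add: v_def)
  assume none: "\<not> (\<exists>q \<in> set (split_range h g l y). x \<in> range_labels Y h g q)"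
  have up: "\<not> (g x < v / l * h x \<and> 1 / l * h x \<le> g x)"
    and down: "\<not> (g x \<le> 1 / l * h x \<and> 1 / (l * v) * h x < g x)"
    using none x(1)
    by (auto simp: split_range_eq[where h = h and g = g, OF l y] v_def range_labels_def feasible_def feasible_swapped_def)
  \<comment> \<open>The slope \<open>1 / l\<close> lies in both ranges, so avoiding them means
    differing from it by a factor of at least \<open>v\<close>.\<close>
  have out: "v * h x \<le> l * g x \<or> v * (l * g x) \<le> h x"
    using up down l v by (auto simp: field_simps not_less not_le)
  have vv: "h y \<le> v * (l * g y)" "l * g y \<le> v * h y"
    using l y by (simp_all add: v_def slope_ratio_label field_simps max_def)
  \<comment> \<open>Each alternative holds two spread conditions: one for when \<open>h y\<close> is
    the smaller term of \<open>y\<close>, one for when \<open>l * g y\<close> is.\<close>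
  have spread: "l * g y * h x \<le> h y * (l * g x) \<and> h y * h x \<le> l * g y * (l * g x)
      \<or> l * g y * (l * g x) \<le> h y * h x \<and> h y * (l * g x) \<le> l * g y * h x"
    using out
  proof
    assume *: "v * h x \<le> l * g x"
    have "l * g y * h x \<le> v * h y * h x"
      using vv x by (intro mult_right_mono) auto
    also have "\<dots> = h y * (v * h x)" by simp
    also have "\<dots> \<le> h y * (l * g x)"
      using * y by (intro mult_left_mono) auto
    finally have 1: "l * g y * h x \<le> h y * (l * g x)" .
    have "h y * h x \<le> v * (l * g y) * h x"
      using vv x by (intro mult_right_mono) auto
    also have "\<dots> = l * g y * (v * h x)" by simp
    also have "\<dots> \<le> l * g y * (l * g x)"
      using * y l by (intro mult_left_mono) auto
    finally show ?thesis using 1 by blast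
  next
    assume *: "v * (l * g x) \<le> h x"
    have "h y * (l * g x) \<le> v * (l * g y) * (l * g x)"
      using vv x l by (intro mult_right_mono) auto
    also have "\<dots> = l * g y * (v * (l * g x))" by simp
    also have "\<dots> \<le> l * g y * h x"
      using * y l by (intro mult_left_mono) auto
    finally have 1: "h y * (l * g x) \<le> l * g y * h x" .
    have "l * g y * (l * g x) \<le> v * h y * (l * g x)"
      using vv x l by (intro mult_right_mono) auto
    also have "\<dots> = h y * (v * (l * g x))" by simp
    also have "\<dots> \<le> h y * h x"
      using * y by (intro mult_left_mono) auto
    finally show ?thesis using 1 by blast
  qed
  have pos: "0 < l * g y" "0 < l * g x"
    using l x y by auto
  have "h x * (l * g x) \<le> h y * (l * g y)"
  proof (cases "h y \<le> l * g y")
    case True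
    from spread show ?thesis
      using prod_le_of_sum_le_of_spread[of "h y" "l * g y" "h x" "l * g x"]
        prod_le_of_sum_le_of_spread[of "h y" "l * g y" "l * g x" "h x"] True pos x y max
      by (auto simp: mult_ac add_ac)
  next
    case False
    from spread show ?thesis
      using prod_le_of_sum_le_of_spread[of "l * g y" "h y" "h x" "l * g x"]
        prod_le_of_sum_le_of_spread[of "l * g y" "h y" "l * g x" "h x"] False pos x y max
      by (auto simp: mult_ac add_ac)
  qed
  then have "l * Phi h g x \<le> l * Phi h g y"
    by (simp add: Phi_def mult_ac)
  then show "Phi h g x \<le> Phi h g y"
    using l by simp
qed

text \<open>Here \<open>1 / l\<close> is the geometric mean of the ends \<open>a\<close> and
  \<open>b\<close>, and every slope between them is within a factor \<open>sqrt (a / b)\<close> of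
  it. This is the halving of the width.\<close>

lemma slope_ratio_square_le:
  assumes ab: "0 < b" "b < a" and y: "0 < h y" "0 < g y" "b * h y \<le> g y" "g y \<le> a * h y"
  shows "(slope_ratio (1 / sqrt (a * b)) (label_vec h g y))\<^sup>2 \<le> a / b"
proof -
  let ?l = "1 / sqrt (a * b)"
  have "(h y / (?l * g y))\<^sup>2 = a * b * (h y * h y) / (g y * g y)"
    using ab by (simp add: power_divide power_mult_distrib power2_eq_square)
  also have "\<dots> = a / b * ((b * h y) * (b * h y) / (g y * g y))"
    using ab by (simp add: field_simps)
  also have "\<dots> \<le> a / b * 1"
    using assms by (intro mult_left_mono) (auto simp: divide_le_eq intro!: mult_mono)
  finally have 1: "(h y / (?l * g y))\<^sup>2 \<le> a / b" by simp
  have "(?l * g y / h y)\<^sup>2 = g y * g y / (a * b * (h y * h y))"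
    using ab by (simp add: power_divide power_mult_distrib power2_eq_square)
  also have "\<dots> = a / b * (g y * g y / ((a * h y) * (a * h y)))"
    using ab by (simp add: field_simps)
  also have "\<dots> \<le> a / b * 1"
    using assms by (intro mult_left_mono) (auto simp: divide_le_eq intro!: mult_mono)
  finally have 2: "(?l * g y / h y)\<^sup>2 \<le> a / b" by simp
  show ?thesis
    using 1 2 by (simp add: slope_ratio_label max_def)
qed

section \<open>Updates of the best label and answers of the oracles\<close>

lemma update_best_Phi:
  obtains w where "update_best h g b y = Some w" "w = y \<or> b = Some w" "Phi h g y \<le> Phi h g w"
    "\<And>x. b = Some x \<Longrightarrow> Phi h g x \<le> Phi h g w"
proof (cases b)
  case None
  then show ?thesis
    by (intro that[of y]) (auto simp: update_best_def)
next
  case (Some a)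
  then show ?thesis
    by (intro that[of "if Phi h g y > Phi h g a then y else a"]) (auto simp: update_best_def)
qed

lemma maximizing_oracle_Some:
  assumes "maximizing_oracle F h g orc" "0 < l" "0 \<le> \<beta>" "ereal \<beta> < \<alpha>" "orc l \<alpha> \<beta> = Some y"
  shows "y \<in> F \<alpha> \<beta>" "\<And>x. x \<in> F \<alpha> \<beta> \<Longrightarrow> h x + l * g x \<le> h y + l * g y"
  using assms unfolding maximizing_oracle_def is_arg_max_def
  by (metis (mono_tags, lifting) option.simps(5) not_less)+

lemma maximizing_oracle_None:
  assumes "maximizing_oracle F h g orc" "0 < l" "0 \<le> \<beta>" "ereal \<beta> < \<alpha>" "orc l \<alpha> \<beta> = None"
  shows "F \<alpha> \<beta> = {}"
  using assms unfolding maximizing_oracle_def by (metis (mono_tags, lifting) option.simps(4))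

section \<open>The invariant of the search\<close>

text \<open>Width is measured by the quotient of the ends. The argument \<open>n\<close> will be one
  more than the number of the range. The condition \<open>b < a\<close> keeps the oracles within the
  arguments on which they are correct.\<close>

definition within_width :: "real \<Rightarrow> real \<Rightarrow> ereal \<times> real \<times> nat \<Rightarrow> bool" where
  "within_width v n q \<longleftrightarrow> (\<exists>a b s. q = (ereal a, b, s) \<and> 0 < b \<and> b < a \<and> a / b \<le> v powr (4 / n))"

text \<open>If \<open>x\<close> is still to be found in a range, the width of that range bounds the
  factor by which the current best label \<open>w\<close> can fall short of it.\<close>

definition covered ::
  "'y set \<Rightarrow> ('y \<Rightarrow> real) \<Rightarrow> ('y \<Rightarrow> real) \<Rightarrow> 'y \<Rightarrow> 'y \<Rightarrow> ereal \<times> real \<times> nat \<Rightarrow> bool" where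
  "covered Y h g x w q \<longleftrightarrow> (\<exists>a b s. q = (ereal a, b, s) \<and> x \<in> range_labels Y h g q
     \<and> Phi h g x \<le> a / b * Phi h g w)"

text \<open>The queue entry at index \<open>i\<close> after \<open>t\<close> iterations is the range number \<open>t + i + 1\<close>.\<close>

definition search_invariant ::
  "'y set \<Rightarrow> ('y \<Rightarrow> real) \<Rightarrow> ('y \<Rightarrow> real) \<Rightarrow> real \<Rightarrow> 'y \<Rightarrow> nat \<Rightarrow> 'y search_state \<Rightarrow> bool" where
  "search_invariant Y h g v x t st \<longleftrightarrow>
     length (queue st) \<le> t + 1 \<and>
     (\<forall>i < length (queue st). within_width v (real (t + i + 2)) (queue st ! i)) \<and>
     (\<exists>w. best st = Some w \<and> 0 < h w \<and> 0 < g w \<and>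
       (Phi h g x \<le> Phi h g w \<or> (\<exists>q \<in> set (queue st). covered Y h g x w q)))"

lemma within_width_mono:
  assumes "within_width v n q" "1 \<le> v" "0 < m" "m \<le> n"
  shows "within_width v m q"
proof -
  have "v powr (4 / n) \<le> v powr (4 / m)"
    using assms by (intro powr_mono divide_left_mono) auto
  then show ?thesis
    using assms(1) unfolding within_width_def by (auto intro: order_trans)
qed

lemma covered_mono:
  assumes "covered Y h g x w q" "within_width v n q" "Phi h g w \<le> Phi h g w'"
  shows "covered Y h g x w' q"
proof -
  obtain a b s where q: "q = (ereal a, b, s)" "0 < b" "b < a"
    using assms(2) unfolding within_width_def by blast
  then have "Phi h g x \<le> a / b * Phi h g w" "x \<in> range_labels Y h g q"
    using assms(1) unfolding covered_def by auto
  moreover have "a / b * Phi h g w \<le> a / b * Phi h g w'"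
    using q assms(3) by (intro mult_left_mono) auto
  ultimately show ?thesis
    using q unfolding covered_def by (auto intro: order_trans)
qed

lemma split_range_within_width:
  assumes l: "0 < l" and y: "0 < h y" "0 < g y" and ne: "h y \<noteq> l * g y"
    and le: "slope_ratio l (label_vec h g y) \<le> v powr (4 / n)"
    and q: "q \<in> set (split_range h g l y)"
  shows "within_width v n q"
proof -
  define w where "w = slope_ratio l (label_vec h g y)"
  have w: "1 < w"
    using one_less_slope_ratio[where h = h and g = g, OF l y ne] by (simp add: w_def)
  have *: "1 / l < w / l" "1 / (l * w) < 1 / l" "0 < 1 / (l * w)" "0 < 1 / l"
    "(w / l) / (1 / l) = w" "(1 / l) / (1 / (l * w)) = w"
    using l w by (auto simp: field_simps)
  from q consider "q = (ereal (w / l), 1 / l, 1)" | "q = (ereal (1 / l), 1 / (l * w), 0)"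
    unfolding split_range_eq[where h = h and g = g, OF l y] w_def by auto
  then show ?thesis
    using * le unfolding within_width_def w_def[symmetric] by cases metis+
qed

text \<open>The end quotient of both new ranges is exactly the factor of
  \<open>Phi_le_slope_ratio\<close>, so a label inside one of them is covered; a label outside both
  is no better than \<open>y\<close>.\<close>

lemma covered_split_range:
  assumes l: "0 < l" and y: "0 < h y" "0 < g y" and x: "x \<in> Y" "0 < h x" "0 < g x"
    and max: "h x + l * g x \<le> h y + l * g y"
    and w: "Phi h g y \<le> Phi h g w"
  shows "Phi h g x \<le> Phi h g w \<or> (\<exists>q \<in> set (split_range h g l y). covered Y h g x w q)"
proof -
  define v where "v = slope_ratio l (label_vec h g y)"
  have v: "1 \<le> v"
    using one_le_slope_ratio[where h = h and g = g, OF l y] by (simp add: v_def)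
  have "Phi h g x \<le> v * Phi h g y"
    unfolding v_def by (rule Phi_le_slope_ratio[where h = h and g = g, OF l y x(2,3) max])
  also have "\<dots> \<le> v * Phi h g w"
    using v w by (intro mult_left_mono) auto
  finally have le: "Phi h g x \<le> v * Phi h g w" .
  have *: "(v / l) / (1 / l) = v" "(1 / l) / (1 / (l * v)) = v"
    using l v by auto
  have "covered Y h g x w q" if "q \<in> set (split_range h g l y)" "x \<in> range_labels Y h g q" for q
  proof -
    from that(1) consider "q = (ereal (v / l), 1 / l, 1)" | "q = (ereal (1 / l), 1 / (l * v), 0)"
      unfolding split_range_eq[where h = h and g = g, OF l y] v_def by auto
    then show ?thesis
      using * le that(2) unfolding covered_def by cases metis+
  qed
  then show ?thesis
    using Phi_le_or_in_split_range[where h = h and g = g, OF l y x max] w by fastforce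
qed

lemma length_split_range: "length (split_range h g l y) = 2"
  by (simp add: split_range_def Let_def)

section \<open>Establishing and preserving the invariant for a fixed label \<open>x\<close>\<close>

context
  fixes Y :: "'y set" and h g :: "'y \<Rightarrow> real" and Oc Uc :: "'y lambda_oracle"
    and x :: 'y
  assumes Oc: "constrained_oracle Y h g Oc"
    and Uc: "constrained_oracle_swapped Y h g Uc"
    and x: "x \<in> Y" "0 < h x" "0 < g x"
begin

text \<open>The initial range has infinite width, so the invariant can start only after one
  iteration, with the slope ratio of the first label as the width of both children.\<close>

lemma search_invariant_first:
  assumes lam0: "0 < lam0" and y: "Oc lam0 \<infinity> 0 = Some y"
  shows "0 < h y" "0 < g y"
    "search_invariant Y h g (slope_ratio lam0 (label_vec h g y)) x 1
       (iteration h g Oc Uc (initial_state lam0))"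
proof -
  note orc = maximizing_oracle_Some[OF Oc[unfolded constrained_oracle_def] lam0 _ _ y]
  show hy: "0 < h y" and gy: "0 < g y"
    using orc(1) by (auto simp: feasible_def)
  have "x \<in> feasible Y h g \<infinity> 0"
    using x by (simp add: feasible_def)
  then have max: "h x + lam0 * g x \<le> h y + lam0 * g y"
    using orc(2) by simp
  define v where "v = slope_ratio lam0 (label_vec h g y)"
  show "search_invariant Y h g (slope_ratio lam0 (label_vec h g y)) x 1
       (iteration h g Oc Uc (initial_state lam0))"
  proof (cases "h y = lam0 * g y")
    case True
    then have "slope_ratio lam0 (label_vec h g y) = 1"
      using hy gy lam0 by (simp add: slope_ratio_label)
    then have "Phi h g x \<le> Phi h g y"
      using Phi_le_slope_ratio[where h = h and g = g, OF lam0 hy gy x(2,3) max] by simp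
    then show ?thesis
      using True y hy gy
      by (simp add: iteration_def initial_state_def search_invariant_def update_best_def)
  next
    case False
    have v: "1 < v"
      using one_less_slope_ratio[where h = h and g = g, OF lam0 hy gy False] by (simp add: v_def)
    \<comment> \<open>The children have width \<open>v\<close>, which is
      \<open>v powr (4 / 4)\<close>; 4 is the argument required at the larger index
      \<open>i = 1\<close>.\<close>
    have "within_width v (real (1 + i + 2)) (split_range h g lam0 y ! i)" if "i < 2" for i
    proof (rule within_width_mono[where n = 4])
      show "within_width v 4 (split_range h g lam0 y ! i)"
        using that v by (intro split_range_within_width[where h = h and g = g, OF lam0 hy gy False])
          (auto simp: v_def length_split_range)
    qed (use that v in auto)
    then show ?thesis
      using covered_split_range[where h = h and g = g, OF lam0 hy gy x max order_refl] False y hy gy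
      by (auto simp: iteration_def initial_state_def search_invariant_def update_best_def
          length_split_range v_def)
  qed
qed

text \<open>Dequeuing lowers every index by one while \<open>t\<close> grows by one, so surviving
  ranges keep their numbers. Only the dequeued range and its children need an argument.\<close>

lemma search_invariant_iteration:
  assumes inv: "search_invariant Y h g v x t st" and v: "1 \<le> v" and ne: "queue st \<noteq> []"
  shows "search_invariant Y h g v x (Suc t) (iteration h g Oc Uc st)"
proof -
  obtain q0 qs where qs: "queue st = q0 # qs"
    using ne by (cases "queue st") auto
  obtain w where w: "best st = Some w" "0 < h w" "0 < g w"
    and cov: "Phi h g x \<le> Phi h g w \<or> covered Y h g x w q0 \<or> (\<exists>q \<in> set qs. covered Y h g x w q)"
    using inv qs unfolding search_invariant_def by auto
  have width: "within_width v (real (t + i + 2)) ((q0 # qs) ! i)" if "i < length (q0 # qs)" for i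
    using inv that unfolding search_invariant_def qs by blast
  have len: "length qs \<le> t"
    using inv qs unfolding search_invariant_def by auto
  have width_qs: "within_width v (real (Suc t + i + 2)) (qs ! i)" if "i < length qs" for i
    using width[of "Suc i"] that by (simp add: add_ac)
  obtain a b s where q0: "q0 = (ereal a, b, s)" and ab: "0 < b" "b < a"
    and wd: "a / b \<le> v powr (4 / real (t + 2))"
    using width[of 0] unfolding within_width_def by auto
  define l where "l = 1 / sqrt (a * b)"
  have l: "0 < l"
    using ab by (simp add: l_def)
  define R where "R = (if s = 0 then Oc l (ereal a) b else Uc l (ereal a) b)"
  have l_eq: "(if b \<noteq> 0 then 1 / sqrt (real_of_ereal (ereal a) * b) else lam st) = l"
    using ab by (simp add: l_def)
  have it: "iteration h g Oc Uc st = (case R of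
          None \<Rightarrow> st\<lparr>queue := qs, lam := l\<rparr>
        | Some y \<Rightarrow>
            if h y = l * g y
            then st\<lparr>queue := qs, lam := l, best := update_best h g (best st) y,
                    returned := Some y\<rparr>
            else st\<lparr>queue := qs @ split_range h g l y, lam := l,
                    best := update_best h g (best st) y\<rparr>)"
    using l_eq by (simp only: iteration_def qs q0 R_def Let_def prod.case list.sel)
  have cov_mono: "\<exists>q \<in> set qs. covered Y h g x w' q"
    if "\<exists>q \<in> set qs. covered Y h g x w q" "Phi h g w \<le> Phi h g w'" for w'
    using that width_qs by (metis covered_mono in_set_conv_nth)
  show ?thesis
  proof (cases R)
    case None
    then have "range_labels Y h g q0 = {}"
      using maximizing_oracle_None[OF Oc[unfolded constrained_oracle_def] l]
        maximizing_oracle_None[OF Uc[unfolded constrained_oracle_swapped_def] l] ab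
      by (auto simp: R_def range_labels_def q0 split: if_splits)
    then have "\<not> covered Y h g x w q0"
      by (auto simp: covered_def)
    then show ?thesis
      using None w cov len width_qs unfolding search_invariant_def it by auto
  next
    case (Some y)
    have y: "y \<in> range_labels Y h g q0
        \<and> (\<forall>z \<in> range_labels Y h g q0. h z + l * g z \<le> h y + l * g y)"
      using Some maximizing_oracle_Some[OF Oc[unfolded constrained_oracle_def] l, of b "ereal a" y]
        maximizing_oracle_Some[OF Uc[unfolded constrained_oracle_swapped_def] l, of b "ereal a" y]
        ab
      by (auto simp: R_def range_labels_def q0 split: if_splits)
    have max: "h x + l * g x \<le> h y + l * g y" if "x \<in> range_labels Y h g q0"
      using y that by blast
    note yb = range_labels_bounds[OF conjunct1[OF y, unfolded q0] ab]
    obtain w' where w': "update_best h g (best st) y = Some w'" "w' = y \<or> best st = Some w'"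
      "Phi h g y \<le> Phi h g w'" "Phi h g w \<le> Phi h g w'"
      using update_best_Phi[of h g "best st" y] w(1) by metis
    have w'_pos: "0 < h w'" "0 < g w'"
      using w'(2) w yb by auto
    show ?thesis
    proof (cases "h y = l * g y")
      case True
      have "Phi h g x \<le> Phi h g y" if "x \<in> range_labels Y h g q0"
      proof -
        have "slope_ratio l (label_vec h g y) = 1"
          using True yb l by (simp add: slope_ratio_label)
        then show ?thesis
          using Phi_le_slope_ratio[where h = h and g = g, OF l yb(2,3) x(2,3) max[OF that]] by simp
      qed
      \<comment> \<open>The search stops here with the other ranges unexplored, so the invariant
        must still allow \<open>x\<close> to lie in one of them.\<close>
      then have "Phi h g x \<le> Phi h g w' \<or> (\<exists>q \<in> set qs. covered Y h g x w' q)"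
        using cov cov_mono w' unfolding covered_def[of _ _ _ _ _ q0] by fastforce
      then show ?thesis
        using Some True w'(1) w'_pos len width_qs unfolding search_invariant_def it by auto
    next
      case False
      define u where "u = slope_ratio l (label_vec h g y)"
      \<comment> \<open>The dequeued range has argument \<open>t + 2\<close>; taking the square root
        of its width doubles this to \<open>2 * t + 4\<close>.\<close>
      have "u\<^sup>2 \<le> a / b"
        unfolding u_def l_def using yb ab by (intro slope_ratio_square_le) auto
      also note wd
      also have "v powr (4 / real (t + 2)) = (v powr (4 / real (2 * t + 4)))\<^sup>2"
      proof -
        have "4 / n = 4 / (2 * n) + 4 / (2 * n)" for n :: real
          by simp
        from this[of "real (t + 2)"] have "4 / real (t + 2) = 4 / real (2 * t + 4) + 4 / real (2 * t + 4)"
          by simp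
        then show ?thesis
          by (simp only: power2_eq_square powr_add)
      qed
      finally have u: "u \<le> v powr (4 / real (2 * t + 4))"
        using power2_le_imp_le powr_ge_zero by blast
      have wsplit: "within_width v (real (2 * t + 4)) q" if "q \<in> set (split_range h g l y)" for q
        using split_range_within_width[where h = h and g = g, OF l yb(2,3) False u[unfolded u_def] that] .
      \<comment> \<open>Since \<open>length qs \<le> t\<close>, the children have index at most
        \<open>t + 1\<close>, so the argument they require is at most
        \<open>2 * t + 4\<close>.\<close>
      have "within_width v (real (Suc t + i + 2)) ((qs @ split_range h g l y) ! i)"
        if "i < length qs + 2" for i
      proof (cases "i < length qs")
        case True
        then show ?thesis
          using width_qs by (simp add: nth_append)
      next
        case False
        then have "(qs @ split_range h g l y) ! i \<in> set (split_range h g l y)"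
          using that by (auto simp: nth_append length_split_range)
        from wsplit[OF this] show ?thesis
          by (rule within_width_mono) (use v that len in auto)
      qed
      moreover have "Phi h g x \<le> Phi h g w'
          \<or> (\<exists>q \<in> set (qs @ split_range h g l y). covered Y h g x w' q)"
        using cov
      proof (elim disjE)
        assume "covered Y h g x w q0"
        then have "x \<in> range_labels Y h g q0"
          unfolding covered_def by blast
        from covered_split_range[where h = h and g = g, OF l yb(2,3) x max[OF this] w'(3)] show ?thesis
          by auto
      qed (use cov_mono w' in auto)
      ultimately show ?thesis
        using Some False w'(1) w'_pos len unfolding search_invariant_def it
        by (auto simp: length_split_range)
    qed
  qed
qed

text \<open>Induction on the iterations, where the step from \<open>t = 0\<close> is
  \<open>search_invariant_first\<close> instead of preservation.\<close>

lemma search_invariant_reaches: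
  assumes "search_reaches h g Oc Uc lam0 T t st" "1 \<le> t" "0 < lam0" "Oc lam0 \<infinity> 0 = Some y"
  shows "search_invariant Y h g (slope_ratio lam0 (label_vec h g y)) x t st"
  using assms
proof (induction rule: search_reaches.induct)
  case start
  then show ?case by simp
next
  case (iterate t st)
  note first = search_invariant_first[OF iterate.prems(2,3)]
  show ?case
  proof (cases "t = 0")
    case True
    from iterate.hyps(1) have "st = initial_state lam0"
      unfolding True by cases auto
    then show ?thesis
      using first(3) True by simp
  next
    case False
    then show ?thesis
      using iterate first one_le_slope_ratio[where h = h and g = g, OF _ first(1,2)]
      by (intro search_invariant_iteration) auto
  qed
qed

end

section \<open>From the invariant to the bound\<close>

text \<open>Either the quotient is at most 1, or it is at most the width of a queued range; the
  argument of that range is \<open>t + i + 2\<close>, which is weakened to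
  \<open>t + 1\<close>.\<close>

lemma search_invariant_bound:
  assumes inv: "search_invariant Y h g v x t st" and v: "1 \<le> v" and w: "best st = Some w"
  shows "Phi h g x / Phi h g w \<le> v powr (4 / (real t + 1))"
proof -
  have pos: "0 < Phi h g w"
    using inv w by (auto simp: search_invariant_def Phi_def)
  consider "Phi h g x \<le> Phi h g w" | q where "q \<in> set (queue st)" "covered Y h g x w q"
    using inv w by (auto simp: search_invariant_def)
  then show ?thesis
  proof cases
    case 1
    then have "Phi h g x / Phi h g w \<le> 1"
      using pos by simp
    also have "\<dots> \<le> v powr (4 / (real t + 1))"
      using v by (intro ge_one_powr_ge_zero) auto
    finally show ?thesis .
  next
    case 2
    then obtain i where "i < length (queue st)" "q = queue st ! i"
      by (auto simp: in_set_conv_nth)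
    then have "within_width v (real (t + i + 2)) q"
      using inv by (auto simp: search_invariant_def)
    then have "within_width v (real t + 1) q"
      using v by (rule within_width_mono) auto
    then obtain r where "Phi h g x \<le> r * Phi h g w" "r \<le> v powr (4 / (real t + 1))"
      using 2(2) unfolding covered_def within_width_def by blast
    then show ?thesis
      using pos by (meson order_trans pos_divide_le_eq)
  qed
qed

theorem theorem4:
  fixes Y :: "'y set" and h g :: "'y \<Rightarrow> real"
    and Oc Uc :: "'y lambda_oracle"
    and lam0 :: real and T t :: nat
    and st :: "'y search_state"
    and y1 ystar yhat :: 'y
  assumes g_nonneg: "\<And>y. y \<in> Y \<Longrightarrow> g y \<ge> 0"
    and Oc: "constrained_oracle Y h g Oc"
    and Uc: "constrained_oracle_swapped Y h g Uc"
    and lam0_pos: "lam0 > 0"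
    and ystar: "is_arg_max (Phi h g) (\<lambda>y. y \<in> Y) ystar"
    and y1: "Oc lam0 \<infinity> 0 = Some y1"
    and t: "t \<ge> 1"
    and reaches: "search_reaches h g Oc Uc lam0 T t st"
    and yhat: "best st = Some yhat"
  shows "Phi h g ystar / Phi h g yhat
           \<le> slope_ratio lam0 (label_vec h g y1) powr (4 / (real t + 1))"
proof -
  have y1_in: "y1 \<in> feasible Y h g \<infinity> 0"
    using maximizing_oracle_Some(1)[OF Oc[unfolded constrained_oracle_def] lam0_pos _ _ y1] by simp
  have star: "ystar \<in> Y" "Phi h g y1 \<le> Phi h g ystar"
    using ystar y1_in by (auto simp: is_arg_max_def feasible_def not_less)
  \<comment> \<open>Feasibility for the initial range makes both factors for \<open>y1\<close>
    positive. The product at the maximizer is then positive too, and \<open>g \<ge> 0\<close>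
    excludes two negative factors.\<close>
  have "0 < Phi h g y1"
    using y1_in by (simp add: feasible_def Phi_def)
  then have "0 < h ystar * g ystar"
    using star(2) by (simp add: Phi_def)
  then have pos: "0 < h ystar" "0 < g ystar"
    using g_nonneg[OF star(1)] by (auto simp: zero_less_mult_iff)
  note first = search_invariant_first[OF Oc Uc star(1) pos lam0_pos y1]
  show ?thesis
    using search_invariant_reaches[OF Oc Uc star(1) pos reaches t lam0_pos y1]
      one_le_slope_ratio[where h = h and g = g, OF lam0_pos first(1,2)] yhat
    by (rule search_invariant_bound)
qed

end
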